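(* Let $H$ be a complex Hilbert space, let $I\subseteq[0,\infty)$ be an interval, let $K\subseteq B(H)^+$ be a convex set, and let $s_1,s_2\in(0,1]$. Let $f:I\to\mathbb{R}$ be operator $s_1$-convex on $I$ for operators in $K$ and let $g:I\to\mathbb{R}$ be operator $s_2$-convex on $I$ for operators in $K$. Then for all positive operators $A,B\in K$ with spectra contained in $I$, the inequality \[ 2^{s_1+s_2-1}\left\langle f\left(\frac{A+B}{2}\right)x,x\right\rangle\left\langle g\left(\frac{A+B}{2}\right)x,x\right\rangle \leq\int_{0}^{1}\langle f(tA+(1-t)B)x,x\rangle\,\langle g(tA+(1-t)B)x,x\rangle\, dt +\beta(s_1+1,s_2+1)M(A,B)(x)+\frac{1}{s_1+s_2+1}N(A,B)(x) \] holds for every $x\in H$ with $\|x\|=1$, where \[ M(A,B)(x)=\langle f(A)x,x\rangle\langle g(A)x,x\rangle+\langle f(B)x,x\rangle\langle g(B)x,x\rangle, \] \[ N(A,B)(x)=\langle f(A)x,x\rangle\langle g(B)x,x\rangle+\langle f(B)x,x\rangle\langle g(A)x,x\rangle. \]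
   Context: $B(H)$ is the algebra of bounded linear operators on $H$, and $B(H)^+$ is the set of all positive operators in $B(H)$. For selfadjoint $A,B\in B(H)$, the operator order $A\le B$ means $\langle Ax,x\rangle\le\langle Bx,x\rangle$ for every $x\in H$. For a selfadjoint $A$ and a continuous function $f$ on the spectrum $Sp(A)$, $f(A)$ is given by the continuous functional calculus. Definition. Let $I$ be an interval in $[0,\infty)$, $K$ a convex subset of $B(H)^+$, and $s\in(0,1]$ fixed. A continuous function $f:I\to\mathbb{R}$ is operator $s$-convex on $I$ for operators in $K$ if \[ f((1-\lambda)A+\lambda B)\le(1-\lambda)^s f(A)+\lambda^s f(B) \] in the operator order, for all $\lambda\in[0,1]$ and all $A,B\in K$ whose spectra are contained in $I$. The Beta function is $\beta(x,y)=\int_0^1 t^{x-1}(1-t)^{y-1}\,dt$ for $x,y>0$.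
   Formalization: When s_1 = 1 it is additionally assumed that f(T) ≥ 0 for all T in K with spectrum in I, and likewise for g when s_2 = 1; without this the claim fails (H = ℂ, s_1 = s_2 = 1, f = -1, g(x) = x², A = 0, B = 1). *)

theory Defs
  imports "HOL-Analysis.Analysis" "HOL-Computational_Algebra.Polynomial"
begin

text \<open>Complex Hilbert spaces. The inner product is linear in its first argument;
  positive definiteness is contained in \<open>cinner_self\<close>, since \<^term>\<open>norm\<close> is a norm,
  and completeness in the superclass \<^class>\<open>banach\<close>.\<close>

class chilbert_space = banach +
  fixes scaleC :: "complex \<Rightarrow> 'a \<Rightarrow> 'a" (infixr "*\<^sub>C" 75)
    and cinner :: "'a \<Rightarrow> 'a \<Rightarrow> complex"
  assumes scaleC_add_right: "a *\<^sub>C (x + y) = a *\<^sub>C x + a *\<^sub>C y"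
    and scaleC_add_left: "(a + b) *\<^sub>C x = a *\<^sub>C x + b *\<^sub>C x"
    and scaleC_scaleC: "a *\<^sub>C b *\<^sub>C x = (a * b) *\<^sub>C x"
    and scaleC_of_real: "complex_of_real r *\<^sub>C x = r *\<^sub>R x"
    and cinner_add_left: "cinner (x + y) z = cinner x z + cinner y z"
    and cinner_scaleC_left: "cinner (a *\<^sub>C x) y = a * cinner x y"
    and cinner_commute: "cinner x y = cnj (cinner y x)"
    and cinner_self: "cinner x x = complex_of_real ((norm x)\<^sup>2)"

text \<open>The algebra $B(H)$: the type of bounded real-linear operators carries the operator
  norm, and \<open>BH\<close> singles out the complex-linear ones.\<close>

definition BH :: "('h::chilbert_space \<Rightarrow>\<^sub>L 'h) set" where
  "BH = {T. \<forall>c x. blinfun_apply T (c *\<^sub>C x) = c *\<^sub>C blinfun_apply T x}"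

definition selfadjoint :: "('h::chilbert_space \<Rightarrow>\<^sub>L 'h) \<Rightarrow> bool" where
  "selfadjoint T \<longleftrightarrow> T \<in> BH \<and>
     (\<forall>x y. cinner (blinfun_apply T x) y = cinner x (blinfun_apply T y))"

text \<open>The number $\langle Tx, x\rangle$, which is real for selfadjoint $T$.\<close>

definition qform :: "('h::chilbert_space \<Rightarrow>\<^sub>L 'h) \<Rightarrow> 'h \<Rightarrow> real" where
  "qform T x = Re (cinner (blinfun_apply T x) x)"

definition op_le :: "('h::chilbert_space \<Rightarrow>\<^sub>L 'h) \<Rightarrow> ('h \<Rightarrow>\<^sub>L 'h) \<Rightarrow> bool" (infix "\<le>\<^sub>o\<^sub>p" 50) where
  "A \<le>\<^sub>o\<^sub>p B \<longleftrightarrow> selfadjoint A \<and> selfadjoint B \<and> (\<forall>x. qform A x \<le> qform B x)"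

definition positive_ops :: "('h::chilbert_space \<Rightarrow>\<^sub>L 'h) set" where
  "positive_ops = {T. 0 \<le>\<^sub>o\<^sub>p T}"

definition Sp :: "('h::chilbert_space \<Rightarrow>\<^sub>L 'h) \<Rightarrow> complex set" where
  "Sp T = {z. \<not> (\<exists>S\<in>BH. \<forall>x.
      blinfun_apply S (blinfun_apply T x - z *\<^sub>C x) = x \<and>
      blinfun_apply T (blinfun_apply S x) - z *\<^sub>C blinfun_apply S x = x)}"

definition op_power :: "('h::chilbert_space \<Rightarrow>\<^sub>L 'h) \<Rightarrow> nat \<Rightarrow> ('h \<Rightarrow>\<^sub>L 'h)" where
  "op_power T n = ((\<lambda>S. T o\<^sub>L S) ^^ n) id_blinfun"

definition poly_op :: "real poly \<Rightarrow> ('h::chilbert_space \<Rightarrow>\<^sub>L 'h) \<Rightarrow> ('h \<Rightarrow>\<^sub>L 'h)" where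
  "poly_op p T = (\<Sum>i\<le>degree p. coeff p i *\<^sub>R op_power T i)"

text \<open>The continuous functional calculus $f(A)$ of a selfadjoint $A$ for real-valued $f$
  continuous on the spectrum: the polynomial calculus $p \mapsto p(A)$ is isometric from the
  supremum norm on $Sp(A)$ to the operator norm, and $f \mapsto f(A)$ is its unique continuous
  extension, so $f(A)$ is the operator-norm limit of $p_n(A)$ for polynomials $p_n$ converging
  to $f$ uniformly on $Sp(A)$. The spectrum of a selfadjoint operator is real.\<close>

definition cfc :: "(real \<Rightarrow> real) \<Rightarrow> ('h::chilbert_space \<Rightarrow>\<^sub>L 'h) \<Rightarrow> ('h \<Rightarrow>\<^sub>L 'h)" where
  "cfc f A = (THE T. \<exists>p :: nat \<Rightarrow> real poly.
     uniform_limit {r. complex_of_real r \<in> Sp A} (\<lambda>n. poly (p n)) f sequentially \<and>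
     (\<lambda>n. poly_op (p n) A) \<longlonglongrightarrow> T)"

definition spectrum_in :: "('h::chilbert_space \<Rightarrow>\<^sub>L 'h) \<Rightarrow> real set \<Rightarrow> bool" where
  "spectrum_in A I \<longleftrightarrow> Sp A \<subseteq> complex_of_real ` I"

text \<open>For $s < 1$ the case $A = B$, $t = 1/2$ of the inequality gives
  $f(A) \le 2^{1-s} f(A)$, hence $f(A) \ge 0$. For $s = 1$ (operator convexity) nothing
  of the kind follows: the constant function $-1$ qualifies.\<close>

definition operator_s_convex ::
    "real \<Rightarrow> real set \<Rightarrow> ('h::chilbert_space \<Rightarrow>\<^sub>L 'h) set \<Rightarrow> (real \<Rightarrow> real) \<Rightarrow> bool" where
  "operator_s_convex s I K f \<longleftrightarrow> continuous_on I f \<and>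
     (\<forall>t\<in>{0..1}. \<forall>A\<in>K. \<forall>B\<in>K. spectrum_in A I \<longrightarrow> spectrum_in B I \<longrightarrow>
        cfc f ((1 - t) *\<^sub>R A + t *\<^sub>R B) \<le>\<^sub>o\<^sub>p
          ((1 - t) powr s) *\<^sub>R cfc f A + (t powr s) *\<^sub>R cfc f B)"

definition M_form :: "(real \<Rightarrow> real) \<Rightarrow> (real \<Rightarrow> real) \<Rightarrow>
    ('h::chilbert_space \<Rightarrow>\<^sub>L 'h) \<Rightarrow> ('h \<Rightarrow>\<^sub>L 'h) \<Rightarrow> 'h \<Rightarrow> real" where
  "M_form f g A B x = qform (cfc f A) x * qform (cfc g A) x + qform (cfc f B) x * qform (cfc g B) x"

definition N_form :: "(real \<Rightarrow> real) \<Rightarrow> (real \<Rightarrow> real) \<Rightarrow>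
    ('h::chilbert_space \<Rightarrow>\<^sub>L 'h) \<Rightarrow> ('h \<Rightarrow>\<^sub>L 'h) \<Rightarrow> 'h \<Rightarrow> real" where
  "N_form f g A B x = qform (cfc f A) x * qform (cfc g B) x + qform (cfc f B) x * qform (cfc g A) x"

end

theory Submission
  imports Defs
begin

text \<open>
  The operators enter only through scalar functions. Write $C_t = tA + (1-t)B$ and
  $\varphi(t) = \langle f(C_t)x, x\rangle$, $\gamma(t) = \langle g(C_t)x, x\rangle$.
  Since the segment from $B$ to $A$ stays in $K$, operator $s$-convexity of $f$ and $g$ becomes ordinary
  $s$-convexity of $\varphi$ and $\gamma$ on $[0,1]$, provided that every $C_t$ again has its
  spectrum in $I$ (\<open>spectrum_in_convex_combination\<close>); and both functions are nonnegative
  (\<open>operator_s_convex_nonneg\<close>). What remains is a Hadamard inequality for two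
  nonnegative scalar functions (\<open>s_convex_unit_product_Hadamard\<close>).

  The scalar inequality: the midpoint of $t$ and $1-t$ is $1/2$, so
  $2^{s_1}\varphi(1/2) \le \varphi(t)+\varphi(1-t)$ and
  $2^{s_2}\gamma(1/2) \le \gamma(t)+\gamma(1-t)$. Multiply these. The diagonal products
  integrate to twice $\int\varphi\gamma$; in the cross products each factor is estimated by
  $s$-convexity from its values at the endpoints $0$ and $1$, and the powers of $t$ and $1-t$ that
  arise integrate to the Beta value and to $1/(s_1+s_2+1)$.
  The integral of $\varphi\gamma$ has to exist: a nonnegative $s$-convex function is bounded on
  $[0,1]$ and continuous on $(0,1)$ (\<open>s_convex_unit_continuous\<close>).

  The spectrum of a convex combination: let $r$ be a real number outside the interval $I$, say below it.
  The infimum of the numerical range of a selfadjoint operator is in the spectrum, so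
  $A - r$ and $B - r$ are both bounded below by a positive constant, and hence so is
  $C_t - r$. An operator with such a coercive form is invertible by a contraction argument.
\<close>

section \<open>Operators with coercive quadratic form\<close>

lemma cinner_add_right: "cinner x (y + z) = cinner x y + cinner x (z::'h::chilbert_space)"
  by (metis cinner_add_left cinner_commute complex_cnj_add)

lemma Re_cinner_commute: "Re (cinner x y) = Re (cinner y (x::'h::chilbert_space))"
  by (subst cinner_commute) simp

lemma cinner_scaleR_left: "cinner (r *\<^sub>R x) y = of_real r * cinner x (y::'h::chilbert_space)"
  by (metis cinner_scaleC_left scaleC_of_real)

lemma Re_cinner_simps:
  fixes x y z :: "'h::chilbert_space"
  shows "Re (cinner (x + y) z) = Re (cinner x z) + Re (cinner y z)"
    and "Re (cinner z (x + y)) = Re (cinner z x) + Re (cinner z y)"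
    and "Re (cinner (r *\<^sub>R x) y) = r * Re (cinner x y)"
    and "Re (cinner x (r *\<^sub>R y)) = r * Re (cinner x y)"
    and "Re (cinner (x - y) z) = Re (cinner x z) - Re (cinner y z)"
    and "Re (cinner z (x - y)) = Re (cinner z x) - Re (cinner z y)"
    and "Re (cinner x x) = (norm x)\<^sup>2"
proof -
  have addl: "Re (cinner (x + y) z) = Re (cinner x z) + Re (cinner y z)" for x y z :: 'h
    by (simp add: cinner_add_left)
  have scl: "Re (cinner (r *\<^sub>R x) y) = r * Re (cinner x y)" for r and x y :: 'h
    by (simp add: cinner_scaleR_left)
  have dif: "Re (cinner (x - y) z) = Re (cinner x z) - Re (cinner y z)" for x y z :: 'h
    using addl[of "x - y" y z] by simp
  show "Re (cinner (x + y) z) = Re (cinner x z) + Re (cinner y z)" by (rule addl)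
  show "Re (cinner z (x + y)) = Re (cinner z x) + Re (cinner z y)"
    by (simp add: cinner_add_right)
  show "Re (cinner (r *\<^sub>R x) y) = r * Re (cinner x y)" by (rule scl)
  show "Re (cinner x (r *\<^sub>R y)) = r * Re (cinner x y)"
    using scl[of r y x] by (metis Re_cinner_commute)
  show "Re (cinner (x - y) z) = Re (cinner x z) - Re (cinner y z)" by (rule dif)
  show "Re (cinner z (x - y)) = Re (cinner z x) - Re (cinner z y)"
    using dif[of x y z] by (metis Re_cinner_commute)
  show "Re (cinner x x) = (norm x)\<^sup>2" by (simp add: cinner_self)
qed

lemma norm_add_sq:
  fixes x y :: "'h::chilbert_space"
  shows "(norm (x + y))\<^sup>2 = (norm x)\<^sup>2 + 2 * Re (cinner x y) + (norm y)\<^sup>2"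
proof -
  have "(norm (x + y))\<^sup>2 = Re (cinner (x + y) (x + y))"
    by (simp add: Re_cinner_simps(7))
  also have "\<dots> = (norm x)\<^sup>2 + 2 * Re (cinner x y) + (norm y)\<^sup>2"
    unfolding Re_cinner_simps(1,2)
    using Re_cinner_commute[of x y] by (simp add: Re_cinner_simps(7))
  finally show ?thesis .
qed

text \<open>
  The norm already satisfies the triangle inequality, so expanding
  $\|x+y\|^2$ gives the Cauchy-Schwarz inequality for the real part.
\<close>

lemma Re_cinner_le_norm: "Re (cinner x y) \<le> norm x * norm (y::'h::chilbert_space)"
proof -
  have "(norm (x + y))\<^sup>2 \<le> (norm x + norm y)\<^sup>2"
    by (simp add: norm_triangle_ineq power_mono)
  then show ?thesis by (simp add: norm_add_sq power2_sum)
qed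

lemma norm_scaleC: "norm (c *\<^sub>C x) = cmod c * norm (x::'h::chilbert_space)"
proof -
  have "cinner (c *\<^sub>C x) (c *\<^sub>C x) = c * cnj (c * cinner x x)"
    by (metis cinner_scaleC_left cinner_commute)
  also have "\<dots> = complex_of_real ((cmod c * norm x)\<^sup>2)"
    by (simp add: cinner_self power_mult_distrib flip: complex_norm_square)
  finally have "(norm (c *\<^sub>C x))\<^sup>2 = (cmod c * norm x)\<^sup>2"
    by (metis cinner_self of_real_eq_iff)
  then show ?thesis by simp
qed

lemma bounded_linear_scaleC: "bounded_linear (\<lambda>x::'h::chilbert_space. c *\<^sub>C x)"
proof (rule bounded_linear_intro[where K = "cmod c"])
  show "c *\<^sub>C (r *\<^sub>R x) = r *\<^sub>R c *\<^sub>C (x::'h)" for r x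
    by (simp add: scaleC_scaleC mult.commute flip: scaleC_of_real)
qed (simp_all add: scaleC_add_right norm_scaleC mult.commute)

text \<open>
  Solving $Lx = y$ amounts to finding a fixed point of $x \mapsto x - q(Lx - y)$. For a small step
  $q$ this is a contraction, because
  $\|x-qLx\|^2 \le (1 - 2q\delta + q^2k^2)\|x\|^2$ when $\|L\| \le k$.
\<close>

lemma coercive_bij:
  fixes L :: "'h::chilbert_space \<Rightarrow> 'h"
  assumes L: "bounded_linear L" and d: "0 < \<delta>"
    and coer: "\<And>x. \<delta> * (norm x)\<^sup>2 \<le> Re (cinner (L x) x)"
  shows "bij L"
proof -
  interpret bounded_linear L by (rule L)
  obtain k where k: "k > 0" "\<And>x. norm (L x) \<le> norm x * k"
    using pos_bounded by blast
  \<comment> \<open>This step minimises the contraction factor $1 - 2q\delta + q^2k^2$, with value $1 - q\delta$.\<close>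
  define q where "q = \<delta> / k\<^sup>2"
  have q0: "q > 0" using d k by (simp add: q_def)
  \<comment> \<open>On the zero space $1 - q\delta$ may be negative, hence the maximum.\<close>
  define c where "c = sqrt (max 0 (1 - q * \<delta>))"
  have contr: "norm (x - q *\<^sub>R L x) \<le> c * norm x" for x
  proof -
    have "(norm (x - q *\<^sub>R L x))\<^sup>2 = (norm x)\<^sup>2 - 2 * q * Re (cinner (L x) x) + q\<^sup>2 * (norm (L x))\<^sup>2"
      using norm_add_sq[of x "(-q) *\<^sub>R L x"] Re_cinner_commute[of x "L x"]
        Re_cinner_simps(4)[of x "-q" "L x"]
      by (simp add: power_mult_distrib)
    also have "\<dots> \<le> (norm x)\<^sup>2 - 2 * q * (\<delta> * (norm x)\<^sup>2) + q\<^sup>2 * (norm x * k)\<^sup>2"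
      using q0 coer[of x] k(2)[of x]
      by (intro add_mono diff_mono mult_left_mono power_mono) auto
    also have "\<dots> = (1 - q * \<delta>) * (norm x)\<^sup>2"
      using k(1) by (simp add: q_def power2_eq_square field_simps)
    also have "\<dots> \<le> max 0 (1 - q * \<delta>) * (norm x)\<^sup>2"
      by (intro mult_right_mono) auto
    also have "\<dots> = (c * norm x)\<^sup>2"
      by (simp add: c_def power_mult_distrib)
    finally show ?thesis
      by (rule power2_le_imp_le) (simp add: c_def)
  qed
  have c: "0 \<le> c" "c < 1"
    using q0 d by (auto simp: c_def)
  show ?thesis
    unfolding bij_iff
  proof
    fix y
    have "\<exists>!x. x - q *\<^sub>R (L x - y) = x"
    proof (rule banach_fix_type[OF c])
      have eq: "(x - q *\<^sub>R (L x - y)) - (z - q *\<^sub>R (L z - y)) = (x - z) - q *\<^sub>R L (x - z)" for x z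
        by (simp add: diff scaleR_right_diff_distrib)
      show "\<forall>x z. dist (x - q *\<^sub>R (L x - y)) (z - q *\<^sub>R (L z - y)) \<le> c * dist x z"
        unfolding dist_norm eq using contr by blast
    qed
    then show "\<exists>!x. L x = y" using q0 by simp
  qed
qed

text \<open>
  The scalar $w$ rotates the numerical range of $T - z$ into a right half-plane: a sign
  serves for real $z$ on either side of the numerical range, an imaginary number for nonreal $z$.
\<close>

lemma coercive_imp_notin_Sp:
  fixes T :: "'h::chilbert_space \<Rightarrow>\<^sub>L 'h"
  assumes T: "T \<in> BH" and d: "0 < \<delta>"
    and coer: "\<And>x. \<delta> * (norm x)\<^sup>2 \<le> Re (w * cinner (T x - z *\<^sub>C x) x)"
  shows "z \<notin> Sp T"
proof -
  define L where "L x = w *\<^sub>C (T x - z *\<^sub>C x)" for x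
  have L: "bounded_linear L"
    unfolding L_def
    by (intro bounded_linear_compose[OF bounded_linear_scaleC] bounded_linear_sub
        blinfun.bounded_linear_right bounded_linear_scaleC)
  interpret bounded_linear L by (rule L)
  have TC: "T (c *\<^sub>C x) = c *\<^sub>C T x" for c x
    using T by (simp add: BH_def)
  have scaleC_diff: "c *\<^sub>C (x - y) = c *\<^sub>C x - c *\<^sub>C (y::'h)" for c x y
    by (rule linear_diff[OF bounded_linear.linear[OF bounded_linear_scaleC]])
  have LC: "L (c *\<^sub>C x) = c *\<^sub>C L x" for c x
    by (simp add: L_def TC scaleC_diff scaleC_scaleC mult.commute mult.left_commute)
  have coerL: "\<delta> * (norm x)\<^sup>2 \<le> Re (cinner (L x) x)" for x
    using coer by (simp add: L_def cinner_scaleC_left)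
  have bij: "bij L" by (rule coercive_bij[OF L d coerL])
  have below: "norm x \<le> norm (L x) * (1 / \<delta>)" for x
  proof (cases "x = 0")
    case False
    have "\<delta> * norm x * norm x \<le> norm (L x) * norm x"
      using order_trans[OF coerL Re_cinner_le_norm] by (simp add: power2_eq_square mult.assoc)
    then show ?thesis using False d by (simp add: field_simps)
  qed simp
  have Linv: "L (inv L y) = y" "inv L (L y) = y" for y
    using bij by (simp_all add: bij_is_surj surj_f_inv_f bij_is_inj)
  have Linv_eq: "inv L y = x" if "L x = y" for x y
    using that Linv(2) by blast
  have invb: "bounded_linear (inv L)"
  proof (rule bounded_linear_intro)
    show "norm (inv L y) \<le> norm y * (1 / \<delta>)" for y
      using below[of "inv L y"] by (simp add: Linv)
  qed (auto intro!: Linv_eq simp: add scaleR Linv)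
  have invC: "inv L (c *\<^sub>C y) = c *\<^sub>C inv L y" for c y
    by (auto intro!: Linv_eq simp: LC Linv)
  define S where "S = Blinfun (\<lambda>y. inv L (w *\<^sub>C y))"
  have S: "blinfun_apply S = (\<lambda>y. inv L (w *\<^sub>C y))"
    unfolding S_def
    by (intro bounded_linear_Blinfun_apply bounded_linear_compose[OF invb] bounded_linear_scaleC)
  have SBH: "S \<in> BH"
    by (simp add: BH_def S invC scaleC_scaleC mult.commute flip: invC)
  have left: "S (T x - z *\<^sub>C x) = x" for x
    using Linv(2)[of x] by (simp add: S L_def)
  have right: "T (S x) - z *\<^sub>C S x = x" for x
  proof (cases "w = 0")
    case True
    then have "\<delta> * (norm y)\<^sup>2 \<le> 0" for y :: 'h using coer[of y] by simp
    then have "y = 0" for y :: 'h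
      using d by (simp add: mult_le_0_iff)
    then show ?thesis by metis
  next
    case False
    have "w *\<^sub>C (T (S x) - z *\<^sub>C S x) = w *\<^sub>C x"
      using Linv(1)[of "w *\<^sub>C x"] by (simp add: L_def S)
    then have "norm (w *\<^sub>C (T (S x) - z *\<^sub>C S x - x)) = 0"
      by (simp add: scaleC_diff)
    then show ?thesis using False by (simp add: norm_scaleC)
  qed
  show ?thesis
    unfolding Sp_def using SBH left right by blast
qed

section \<open>Spectrum and numerical range\<close>

text \<open>
  For $P = \sigma(A - r) \ge 0$ positivity of the form at $x - Px/k$, where $\|P\| \le k$, gives
  $\langle Px,x\rangle \ge \|Px\|^2/k$. If $P$ is invertible, $\|Px\|$ dominates a multiple of $\|x\|$.
  The sign $\sigma$ allows bounds from below and from above to be treated at once.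
\<close>

lemma lower_bound_uniform_off_Sp:
  fixes A :: "'h::chilbert_space \<Rightarrow>\<^sub>L 'h"
  assumes sa: "selfadjoint A" and \<sigma>: "\<bar>\<sigma>\<bar> = 1"
    and nonneg: "\<And>x. 0 \<le> \<sigma> * (qform A x - r * (norm x)\<^sup>2)"
    and notin: "complex_of_real r \<notin> Sp A"
  shows "\<exists>\<delta>>0. \<forall>x. \<delta> * (norm x)\<^sup>2 \<le> \<sigma> * (qform A x - r * (norm x)\<^sup>2)"
proof -
  define P where "P x = \<sigma> *\<^sub>R (A x - r *\<^sub>R x)" for x
  have P: "bounded_linear P"
    unfolding P_def
    by (intro bounded_linear_scaleR_right bounded_linear_sub blinfun.bounded_linear_right
        bounded_linear_compose[OF bounded_linear_scaleR_right] bounded_linear_ident)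
  interpret bounded_linear P by (rule P)
  obtain k where k: "k > 0" "\<And>x. norm (P x) \<le> norm x * k"
    using pos_bounded by blast
  have Q: "\<sigma> * (qform A x - r * (norm x)\<^sup>2) = Re (cinner (P x) x)" for x
    by (simp add: P_def qform_def Re_cinner_simps)
  have sym: "Re (cinner (P x) y) = Re (cinner x (P y))" for x y
    using sa by (simp add: selfadjoint_def P_def Re_cinner_simps)
  have form_ge: "(norm (P x))\<^sup>2 / k \<le> Re (cinner (P x) x)" for x
  proof -
    have "0 \<le> Re (cinner (P (x - (1/k) *\<^sub>R P x)) (x - (1/k) *\<^sub>R P x))"
      using nonneg Q by metis
    also have "\<dots> = Re (cinner (P x) x) - 2 / k * (norm (P x))\<^sup>2 + Re (cinner (P (P x)) (P x)) / k\<^sup>2"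
      using sym[of "P x" x]
      by (simp add: diff scaleR Re_cinner_simps diff_divide_distrib power2_eq_square)
    also have "Re (cinner (P (P x)) (P x)) \<le> k * (norm (P x))\<^sup>2"
    proof -
      have "Re (cinner (P (P x)) (P x)) \<le> (norm (P x) * k) * norm (P x)"
        by (rule order_trans[OF Re_cinner_le_norm]) (simp add: k mult_right_mono)
      then show ?thesis by (simp add: power2_eq_square mult_ac)
    qed
    finally have "0 \<le> Re (cinner (P x) x) - 2 / k * (norm (P x))\<^sup>2 + k * (norm (P x))\<^sup>2 / k\<^sup>2"
      using k(1) by (simp add: divide_right_mono)
    then show ?thesis using k(1) by (simp add: power2_eq_square)
  qed
  obtain S :: "'h \<Rightarrow>\<^sub>L 'h" where S: "S (A x - complex_of_real r *\<^sub>C x) = x" for x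
    using notin unfolding Sp_def by auto
  have below: "(norm x)\<^sup>2 \<le> (norm S + 1)\<^sup>2 * (norm (P x))\<^sup>2" for x
  proof -
    have "norm x = norm (S (A x - r *\<^sub>R x))"
      using S[of x] by (simp add: scaleC_of_real)
    also have "\<dots> \<le> norm S * norm (A x - r *\<^sub>R x)" by (rule norm_blinfun)
    also have "\<dots> \<le> (norm S + 1) * norm (P x)"
      using \<sigma> by (simp add: P_def mult_right_mono)
    finally have "(norm x)\<^sup>2 \<le> ((norm S + 1) * norm (P x))\<^sup>2"
      by (intro power_mono) auto
    then show ?thesis by (simp only: power_mult_distrib)
  qed
  show ?thesis
  proof (intro exI conjI allI)
    show "0 < 1 / (k * (norm S + 1)\<^sup>2)"
      using k(1) by (intro divide_pos_pos mult_pos_pos zero_less_power add_nonneg_pos) auto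
    show "1 / (k * (norm S + 1)\<^sup>2) * (norm x)\<^sup>2 \<le> \<sigma> * (qform A x - r * (norm x)\<^sup>2)" for x
    proof -
      have "0 < norm S + 1" by (intro add_nonneg_pos) auto
      then have "(norm x)\<^sup>2 / (norm S + 1)\<^sup>2 \<le> (norm (P x))\<^sup>2"
        using below[of x] by (simp add: pos_divide_le_eq mult.commute)
      from divide_right_mono[OF this, of k]
      have "1 / (k * (norm S + 1)\<^sup>2) * (norm x)\<^sup>2 \<le> (norm (P x))\<^sup>2 / k"
        using k(1) by (simp add: mult.commute)
      then show ?thesis using form_ge[of x] Q[of x] by simp
    qed
  qed
qed

lemma qform_scaleR_vec: "qform A (r *\<^sub>R x) = r\<^sup>2 * qform A x"
  by (simp add: qform_def blinfun.scaleR_right Re_cinner_simps power2_eq_square)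

text \<open>
  The number $\sigma m$ below is the end of the numerical range that faces $r$. By
  \<open>lower_bound_uniform_off_Sp\<close> it belongs to the spectrum, as otherwise $m$ could be
  enlarged. Hence it lies in $I$, strictly on the far side of $r$, and $m - \sigma r$ serves as the gap $\delta$.
\<close>

lemma spectrum_beside_imp_form_beside:
  fixes A :: "'h::chilbert_space \<Rightarrow>\<^sub>L 'h"
  assumes sa: "selfadjoint A" and \<sigma>: "\<bar>\<sigma>\<bar> = 1" and sp: "spectrum_in A I"
    and side: "\<And>i. i \<in> I \<Longrightarrow> 0 < \<sigma> * (i - r)"
  shows "\<exists>\<delta>>0. \<forall>x. \<delta> * (norm x)\<^sup>2 \<le> \<sigma> * (qform A x - r * (norm x)\<^sup>2)"
proof (cases "\<exists>x::'h. norm x = 1")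
  case False
  have "x = 0" for x :: 'h
    using False[simplified, rule_format, of "sgn x"] by (simp add: norm_sgn split: if_splits)
  then have "1 * (norm x)\<^sup>2 \<le> \<sigma> * (qform A x - r * (norm x)\<^sup>2)" for x
    using qform_scaleR_vec[of A 0 x] by (subst (1 2 3) \<open>\<And>x. x = 0\<close>) simp
  then show ?thesis using zero_less_one by blast
next
  case True
  define V where "V = (\<lambda>x. \<sigma> * qform A x) ` {x. norm x = 1}"
  define m where "m = Inf V"
  have V: "V \<noteq> {}" using True by (auto simp: V_def)
  have bdd: "bdd_below V"
  proof (rule bdd_belowI)
    fix v assume "v \<in> V"
    then obtain x where x: "norm x = 1" "v = \<sigma> * qform A x" by (auto simp: V_def)
    have "- v = Re (cinner (A x) ((-\<sigma>) *\<^sub>R x))"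
      using Re_cinner_simps(4)[of "A x" "-\<sigma>" x] by (simp add: x(2) qform_def)
    also have "\<dots> \<le> norm (A x) * norm ((-\<sigma>) *\<^sub>R x)" by (rule Re_cinner_le_norm)
    also have "\<dots> \<le> norm A"
      using norm_blinfun[of A x] x(1) \<sigma> by simp
    finally show "- norm A \<le> v" by simp
  qed
  have ge: "m * (norm x)\<^sup>2 \<le> \<sigma> * qform A x" for x
  proof (cases "x = 0")
    case True
    then show ?thesis using qform_scaleR_vec[of A 0 x] by simp
  next
    case False
    then have "m \<le> \<sigma> * qform A (sgn x)"
      unfolding m_def by (intro cInf_lower bdd) (auto simp: V_def norm_sgn)
    then show ?thesis using False
      by (simp add: sgn_div_norm qform_scaleR_vec field_simps)
  qed
  have \<sigma>\<sigma>: "\<sigma> * \<sigma> = 1" using \<sigma> abs_mult_self_eq[of \<sigma>] by simp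
  then have \<sigma>\<sigma>': "\<sigma> * (\<sigma> * y) = y" for y by (simp flip: mult.assoc)
  have shifted: "0 \<le> \<sigma> * (qform A x - (\<sigma> * m) * (norm x)\<^sup>2)" for x
    using ge[of x] by (simp add: right_diff_distrib \<sigma>\<sigma>' mult.assoc)
  have "complex_of_real (\<sigma> * m) \<in> Sp A"
  proof (rule ccontr)
    assume "complex_of_real (\<sigma> * m) \<notin> Sp A"
    then obtain \<delta> where \<delta>: "\<delta> > 0"
      "\<And>x. \<delta> * (norm x)\<^sup>2 \<le> \<sigma> * (qform A x - (\<sigma> * m) * (norm x)\<^sup>2)"
      using lower_bound_uniform_off_Sp[OF sa \<sigma>, of "\<sigma> * m"] shifted by blast
    have above: "m + \<delta> \<le> v" if "v \<in> V" for v
    proof -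
      obtain x where "norm x = 1" "v = \<sigma> * qform A x" using \<open>v \<in> V\<close> by (auto simp: V_def)
      then show ?thesis using \<delta>(2)[of x] by (simp add: right_diff_distrib \<sigma>\<sigma>')
    qed
    have "m + \<delta> \<le> Inf V" by (intro cInf_greatest[OF V] above)
    then have "m + \<delta> \<le> m" by (simp only: m_def)
    then show False using \<delta>(1) by simp
  qed
  then have "complex_of_real (\<sigma> * m) \<in> complex_of_real ` I"
    using sp unfolding spectrum_in_def by blast
  then have "\<sigma> * m \<in> I" by (simp only: image_iff of_real_eq_iff) simp
  then have "0 < m - \<sigma> * r" using side[of "\<sigma> * m"] by (simp add: right_diff_distrib \<sigma>\<sigma>')
  moreover have "\<forall>x. (m - \<sigma> * r) * (norm x)\<^sup>2 \<le> \<sigma> * (qform A x - r * (norm x)\<^sup>2)"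
    using ge by (simp add: algebra_simps)
  ultimately show ?thesis by blast
qed

lemma selfadjoint_combination:
  fixes A B :: "'h::chilbert_space \<Rightarrow>\<^sub>L 'h"
  assumes "selfadjoint A" "selfadjoint B"
  shows "selfadjoint (a *\<^sub>R A + b *\<^sub>R B)"
proof -
  have BH: "A (c *\<^sub>C x) = c *\<^sub>C A x" "B (c *\<^sub>C x) = c *\<^sub>C B x" for c x
    using assms by (simp_all add: selfadjoint_def BH_def)
  have scaleR_scaleC: "a *\<^sub>R c *\<^sub>C y = c *\<^sub>C a *\<^sub>R y" for a c and y :: 'h
    by (simp add: scaleC_scaleC mult.commute flip: scaleC_of_real)
  have sc: "cinner x (a *\<^sub>R y) = of_real a * cinner x y" for a and x y :: 'h
    by (metis cinner_scaleR_left cinner_commute complex_cnj_mult complex_cnj_complex_of_real)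
  show ?thesis
    using assms
    by (simp add: selfadjoint_def BH_def blinfun.add_left blinfun.scaleR_left BH scaleC_add_right
        cinner_add_left cinner_add_right cinner_scaleR_left sc scaleR_scaleC)
qed

lemma qform_combination:
  "qform (a *\<^sub>R A + b *\<^sub>R B) x = a * qform A x + b * qform B x"
  by (simp add: qform_def blinfun.add_left blinfun.scaleR_left Re_cinner_simps)

text \<open>
  For $b = \mathrm{Im}\,z$ the factor $ib$ makes the form of $C - z$ coercive:
  $\langle Cx,x\rangle$ is real, so the real part of $ib\langle (C-z)x,x\rangle$ equals $b^2\|x\|^2$.
\<close>

lemma Sp_selfadjoint_real:
  assumes "selfadjoint C" and "z \<in> Sp C"
  shows "Im z = 0"
proof (rule ccontr)
  assume im: "Im z \<noteq> 0"
  have "z \<notin> Sp C"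
  proof (rule coercive_imp_notin_Sp)
    show "C \<in> BH" using assms(1) by (simp add: selfadjoint_def)
    show "0 < (Im z)\<^sup>2" using im by simp
    fix x
    have "cinner (C x) x = cnj (cinner (C x) x)"
      using assms(1) by (metis selfadjoint_def cinner_commute)
    then have "Im (cinner (C x) x) = 0" by (metis Reals_cnj_iff complex_is_Real_iff)
    moreover have "cinner (C x - z *\<^sub>C x) x = cinner (C x) x - z * complex_of_real ((norm x)\<^sup>2)"
      by (metis add_diff_cancel cinner_add_left cinner_scaleC_left cinner_self diff_add_cancel)
    ultimately show "(Im z)\<^sup>2 * (norm x)\<^sup>2 \<le> Re ((\<i> * of_real (Im z)) * cinner (C x - z *\<^sub>C x) x)"
      by (simp add: power2_eq_square)
  qed
  with assms(2) show False by simp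
qed

text \<open>
  A real $r$ outside an interval has the whole interval on one side. The forms of
  $\sigma(A-r)$ and $\sigma(B-r)$ are then coercive, and coercivity passes to convex combinations.
\<close>

lemma spectrum_in_convex_combination:
  fixes A B :: "'h::chilbert_space \<Rightarrow>\<^sub>L 'h"
  assumes I: "is_interval I" and sa: "selfadjoint A" "selfadjoint B"
    and sp: "spectrum_in A I" "spectrum_in B I" and t: "0 \<le> t" "t \<le> 1"
  shows "spectrum_in (t *\<^sub>R A + (1 - t) *\<^sub>R B) I"
  unfolding spectrum_in_def
proof
  let ?C = "t *\<^sub>R A + (1 - t) *\<^sub>R B"
  have saC: "selfadjoint ?C" by (intro selfadjoint_combination sa)
  fix z assume z: "z \<in> Sp ?C"
  define r where "r = Re z"
  have zr: "z = complex_of_real r"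
    using Sp_selfadjoint_real[OF saC z] by (simp add: r_def complex_eq_iff)
  have "r \<in> I"
  proof (rule ccontr)
    assume "r \<notin> I"
    then have "(\<forall>i\<in>I. r < i) \<or> (\<forall>i\<in>I. i < r)"
      using I unfolding is_interval_1 by (metis linorder_less_linear less_imp_le)
    then obtain \<sigma> :: real where \<sigma>: "\<bar>\<sigma>\<bar> = 1" "\<And>i. i \<in> I \<Longrightarrow> 0 < \<sigma> * (i - r)"
    proof
      assume "\<forall>i\<in>I. r < i" then show ?thesis by (intro that[of 1]) auto
    next
      assume "\<forall>i\<in>I. i < r" then show ?thesis by (intro that[of "-1"]) auto
    qed
    obtain d1 where d1: "d1 > 0" "\<And>x. d1 * (norm x)\<^sup>2 \<le> \<sigma> * (qform A x - r * (norm x)\<^sup>2)"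
      using spectrum_beside_imp_form_beside[OF sa(1) \<sigma>(1) sp(1) \<sigma>(2)] by blast
    obtain d2 where d2: "d2 > 0" "\<And>x. d2 * (norm x)\<^sup>2 \<le> \<sigma> * (qform B x - r * (norm x)\<^sup>2)"
      using spectrum_beside_imp_form_beside[OF sa(2) \<sigma>(1) sp(2) \<sigma>(2)] by blast
    have "z \<notin> Sp ?C"
    proof (rule coercive_imp_notin_Sp)
      show "?C \<in> BH" using saC by (simp add: selfadjoint_def)
      show "0 < min d1 d2" using d1 d2 by simp
      fix x
      have 1: "min d1 d2 * (norm x)\<^sup>2 \<le> \<sigma> * (qform A x - r * (norm x)\<^sup>2)"
        by (rule order_trans[OF _ d1(2)]) (simp add: mult_right_mono)
      have 2: "min d1 d2 * (norm x)\<^sup>2 \<le> \<sigma> * (qform B x - r * (norm x)\<^sup>2)"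
        by (rule order_trans[OF _ d2(2)]) (simp add: mult_right_mono)
      have "min d1 d2 * (norm x)\<^sup>2
          = t * (min d1 d2 * (norm x)\<^sup>2) + (1 - t) * (min d1 d2 * (norm x)\<^sup>2)"
        by (simp add: algebra_simps)
      also have "\<dots> \<le> t * (\<sigma> * (qform A x - r * (norm x)\<^sup>2)) + (1 - t) * (\<sigma> * (qform B x - r * (norm x)\<^sup>2))"
        using t 1 2 by (intro add_mono mult_left_mono) auto
      also have "\<dots> = \<sigma> * (qform ?C x - r * (norm x)\<^sup>2)"
        unfolding qform_combination by (simp add: algebra_simps)
      also have "\<dots> = Re (of_real \<sigma> * cinner (?C x - z *\<^sub>C x) x)"
        by (simp add: qform_def zr scaleC_of_real Re_cinner_simps)
      finally show "min d1 d2 * (norm x)\<^sup>2 \<le> Re (of_real \<sigma> * cinner (?C x - z *\<^sub>C x) x)" .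
    qed
    with z show False by simp
  qed
  then show "z \<in> complex_of_real ` I" by (simp add: zr)
qed

section \<open>Scalar s-convex functions on the unit interval\<close>

text \<open>Breckner's $s$-convexity in the second sense, on $[0,1]$.\<close>

definition s_convex_unit :: "real \<Rightarrow> (real \<Rightarrow> real) \<Rightarrow> bool" where
  "s_convex_unit s \<phi> \<longleftrightarrow> (\<forall>l\<in>{0..1}. \<forall>t\<in>{0..1}. \<forall>u\<in>{0..1}.
     \<phi> ((1 - l) * t + l * u) \<le> (1 - l) powr s * \<phi> t + l powr s * \<phi> u)"

text \<open>
  A one-sided modulus of continuity: as $w$ approaches $t$ the last term tends to $0$. Nonnegativity of
  $\varphi(t)$ lets its coefficient $(1-\lambda)^s$ be replaced by $1$.
\<close>

lemma s_convex_unit_segment: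
  assumes "s_convex_unit s \<phi>" "0 < s" and nn: "\<And>t. t \<in> {0..1} \<Longrightarrow> 0 \<le> \<phi> t"
    and tv: "t \<in> {0..1}" "v \<in> {0..1}" "t \<noteq> v" and w: "w \<in> closed_segment t v"
  shows "\<phi> w \<le> \<phi> t + (\<bar>w - t\<bar> / \<bar>v - t\<bar>) powr s * \<phi> v"
proof -
  obtain l where l: "0 \<le> l" "l \<le> 1" "w = (1 - l) * t + l * v"
    using w by (auto simp: in_segment)
  have "w - t = l * (v - t)" using l(3) by (simp add: algebra_simps)
  then have "\<bar>w - t\<bar> / \<bar>v - t\<bar> = l" using tv l by (simp add: abs_mult)
  moreover have "\<phi> w \<le> (1 - l) powr s * \<phi> t + l powr s * \<phi> v"
    using assms(1) l tv by (auto simp: s_convex_unit_def)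
  moreover have "(1 - l) powr s * \<phi> t \<le> 1 * \<phi> t"
    using l nn[OF tv(1)] assms(2) by (intro mult_right_mono powr_le1) auto
  ultimately show ?thesis by simp
qed

lemma s_convex_unit_le:
  assumes "s_convex_unit s \<phi>" "t \<in> {0..1}"
  shows "\<phi> t \<le> t powr s * \<phi> 1 + (1 - t) powr s * \<phi> 0"
  using assms(1)[unfolded s_convex_unit_def, rule_format, of t 0 1] assms(2) by simp

lemma s_convex_unit_bounded:
  assumes "s_convex_unit s \<phi>" "0 < s" and nn: "\<And>t. t \<in> {0..1} \<Longrightarrow> 0 \<le> \<phi> t" and t: "t \<in> {0..1}"
  shows "\<phi> t \<le> \<phi> 1 + \<phi> 0"
proof -
  have "t powr s * \<phi> 1 + (1 - t) powr s * \<phi> 0 \<le> 1 * \<phi> 1 + 1 * \<phi> 0"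
    using t nn[of 0] nn[of 1] assms(2) by (intro add_mono mult_right_mono powr_le1) auto
  with s_convex_unit_le[OF assms(1) t] show ?thesis by simp
qed

text \<open>
  Of two interior points each lies between the other and an endpoint of $[0,1]$, so the
  one-sided estimate applies in both directions. At the endpoints themselves continuity can fail.
\<close>

lemma s_convex_unit_continuous:
  assumes cv: "s_convex_unit s \<phi>" "0 < s" and nn: "\<And>t. t \<in> {0..1} \<Longrightarrow> 0 \<le> \<phi> t"
  shows "continuous_on {0<..<1} \<phi>"
proof (rule continuous_at_imp_continuous_on, rule ballI)
  fix t :: real assume t: "t \<in> {0<..<1}"
  \<comment> \<open>A point on one side of $t$ is at distance at least $d$ from the endpoint on the other side.\<close>
  define d where "d = min t (1 - t)"
  have d: "d > 0" using t by (simp add: d_def)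
  define c where "c = \<phi> 1 + \<phi> 0"
  have one: "\<phi> w \<le> \<phi> u + (\<bar>w - u\<bar> / d) powr s * c"
    if "u \<in> {0..1}" "v \<in> {0, 1}" "w \<in> closed_segment u v" "d \<le> \<bar>v - u\<bar>" for u v w
  proof -
    have "\<phi> w \<le> \<phi> u + (\<bar>w - u\<bar> / \<bar>v - u\<bar>) powr s * \<phi> v"
      using that d by (intro s_convex_unit_segment[OF cv nn]) auto
    also have "(\<bar>w - u\<bar> / \<bar>v - u\<bar>) powr s * \<phi> v \<le> (\<bar>w - u\<bar> / d) powr s * c"
      using that d cv(2) nn[of 0] nn[of 1]
      by (intro mult_mono powr_mono2 divide_left_mono mult_pos_pos) (auto simp: c_def)
    finally show ?thesis by simp
  qed
  have est: "\<bar>\<phi> y - \<phi> t\<bar> \<le> (\<bar>y - t\<bar> / d) powr s * c" if y: "y \<in> {0<..<1}" for y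
  proof (cases "t \<le> y")
    case True
    have "\<phi> y \<le> \<phi> t + (\<bar>y - t\<bar> / d) powr s * c"
      using True t y by (intro one[of t 1]) (auto simp: d_def closed_segment_eq_real_ivl)
    moreover have "\<phi> t \<le> \<phi> y + (\<bar>t - y\<bar> / d) powr s * c"
      using True t y by (intro one[of y 0]) (auto simp: d_def closed_segment_eq_real_ivl)
    ultimately show ?thesis by (simp add: abs_minus_commute)
  next
    case False
    have "\<phi> y \<le> \<phi> t + (\<bar>y - t\<bar> / d) powr s * c"
      using False t y by (intro one[of t 0]) (auto simp: d_def closed_segment_eq_real_ivl)
    moreover have "\<phi> t \<le> \<phi> y + (\<bar>t - y\<bar> / d) powr s * c"
      using False t y by (intro one[of y 1]) (auto simp: d_def closed_segment_eq_real_ivl)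
    ultimately show ?thesis by (simp add: abs_minus_commute)
  qed
  have "((\<lambda>y. (\<bar>y - t\<bar> / d) powr s * c) \<longlongrightarrow> 0) (at t)"
  proof -
    have "((\<lambda>y. (\<bar>y - t\<bar> / d)) \<longlongrightarrow> \<bar>t - t\<bar> / d) (at t)"
      using d by (intro tendsto_intros) auto
    then have "((\<lambda>y. (\<bar>y - t\<bar> / d) powr s) \<longlongrightarrow> 0) (at t)"
      using d cv(2) by (intro tendsto_zero_powrI[of _ _ "\<lambda>_. s" s]) auto
    then show ?thesis by (rule tendsto_mult_left_zero)
  qed
  moreover have "eventually (\<lambda>y. norm (\<phi> y - \<phi> t) \<le> (\<bar>y - t\<bar> / d) powr s * c) (at t)"
    using eventually_at_in_open'[OF open_greaterThanLessThan t] by eventually_elim (use est in auto)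
  ultimately have "((\<lambda>y. \<phi> y - \<phi> t) \<longlongrightarrow> 0) (at t)"
    by (rule Lim_null_comparison[rotated])
  then show "isCont \<phi> t" by (simp add: isCont_def LIM_zero_iff)
qed

lemma s_convex_unit_product_integrable:
  assumes cv1: "s_convex_unit s1 \<phi>" "0 < s1" and nn1: "\<And>t. t \<in> {0..1} \<Longrightarrow> 0 \<le> \<phi> t"
    and cv2: "s_convex_unit s2 \<gamma>" "0 < s2" and nn2: "\<And>t. t \<in> {0..1} \<Longrightarrow> 0 \<le> \<gamma> t"
  shows "(\<lambda>t. \<phi> t * \<gamma> t) integrable_on {0..1}"
proof -
  have "(\<lambda>t. \<phi> t * \<gamma> t) integrable_on {0<..<1}"
  proof (rule measurable_bounded_by_integrable_imp_integrable)
    have "continuous_on {0<..<1} (\<lambda>t. \<phi> t * \<gamma> t)"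
      using s_convex_unit_continuous[OF cv1 nn1] s_convex_unit_continuous[OF cv2 nn2]
      by (rule continuous_on_mult)
    then show "(\<lambda>t. \<phi> t * \<gamma> t) \<in> borel_measurable (lebesgue_on {0<..<1})"
      by (rule continuous_imp_measurable_on_sets_lebesgue) simp
    show "(\<lambda>t. (\<phi> 1 + \<phi> 0) * (\<gamma> 1 + \<gamma> 0)) integrable_on {0<..<1::real}"
      by (simp add: integrable_const_ivl flip: integrable_on_Icc_iff_Ioo)
    show "norm (\<phi> t * \<gamma> t) \<le> (\<phi> 1 + \<phi> 0) * (\<gamma> 1 + \<gamma> 0)" if "t \<in> {0<..<1}" for t
      using that nn1[of t] nn2[of t] nn1[of 1] nn1[of 0]
        s_convex_unit_bounded[OF cv1 nn1, of t] s_convex_unit_bounded[OF cv2 nn2, of t]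
      by (auto simp: abs_mult intro!: mult_mono)
  qed simp
  then show ?thesis by (simp add: integrable_on_Icc_iff_Ioo)
qed

lemma le_twice_integral_of_symmetrized:
  fixes u :: "real \<Rightarrow> real"
  assumes u: "(u has_integral J) {0..1}" and le: "\<And>t. t \<in> {0..1} \<Longrightarrow> c \<le> u t + u (1 - t)"
  shows "c \<le> 2 * J"
proof -
  have "((\<lambda>t. u (1 - t)) has_integral J) {0..1}"
    using has_integral_affinity[of u J 0 1 "-1" 1] u by simp
  from has_integral_add[OF u this] have "((\<lambda>t. u t + u (1 - t)) has_integral (2 * J)) {0..1}"
    by simp
  moreover have "((\<lambda>t. c) has_integral c) {0..1::real}"
    using has_integral_const_real[of c 0 1] by simp
  ultimately show ?thesis using le by (meson has_integral_le)
qed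

text \<open>
  With $h = \varphi\gamma$ and $r$ the endpoint bound for $\varphi(t)\gamma(1-t)$, the product of
  the two midpoint inequalities is at most $u(t) + u(1-t)$ with $u = h + r$. Integrating this
  symmetrized bound produces the factor $2$ that turns $2^{s_1+s_2}$ into $2^{s_1+s_2-1}$.
\<close>

lemma s_convex_unit_product_Hadamard:
  assumes cv1: "s_convex_unit s1 \<phi>" "0 < s1" and nn1: "\<And>t. t \<in> {0..1} \<Longrightarrow> 0 \<le> \<phi> t"
    and cv2: "s_convex_unit s2 \<gamma>" "0 < s2" and nn2: "\<And>t. t \<in> {0..1} \<Longrightarrow> 0 \<le> \<gamma> t"
  shows "2 powr (s1 + s2 - 1) * \<phi> (1/2) * \<gamma> (1/2)
    \<le> integral {0..1} (\<lambda>t. \<phi> t * \<gamma> t)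
      + Beta (s1 + 1) (s2 + 1) * (\<phi> 1 * \<gamma> 1 + \<phi> 0 * \<gamma> 0)
      + 1 / (s1 + s2 + 1) * (\<phi> 1 * \<gamma> 0 + \<phi> 0 * \<gamma> 1)" (is "_ \<le> ?J")
proof -
  define r where "r t = (t powr s1 * \<phi> 1 + (1 - t) powr s1 * \<phi> 0)
      * ((1 - t) powr s2 * \<gamma> 1 + t powr s2 * \<gamma> 0)" for t
  have h: "((\<lambda>t. \<phi> t * \<gamma> t) has_integral integral {0..1} (\<lambda>t. \<phi> t * \<gamma> t)) {0..1}"
    using s_convex_unit_product_integrable[OF cv1 nn1 cv2 nn2] by (simp add: integrable_integral)
  have b: "((\<lambda>t. t powr s1 * (1 - t) powr s2) has_integral Beta (s1 + 1) (s2 + 1)) {0..1}"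
    using has_integral_Beta_real[of "s1 + 1" "s2 + 1"] cv1 cv2 by simp
  have b': "((\<lambda>t. t powr s2 * (1 - t) powr s1) has_integral Beta (s1 + 1) (s2 + 1)) {0..1}"
    using has_integral_Beta_real[of "s2 + 1" "s1 + 1"] cv1 cv2 by (simp add: Beta_commute)
  have p: "((\<lambda>t. t powr (s1 + s2)) has_integral 1 / (s1 + s2 + 1)) {0..1::real}"
    using has_integral_powr_from_0[of "s1 + s2" 1] cv1 cv2 by simp
  have p': "((\<lambda>t. (1 - t) powr (s1 + s2)) has_integral 1 / (s1 + s2 + 1)) {0..1::real}"
    using has_integral_affinity[of "\<lambda>t. t powr (s1 + s2)" _ 0 1 "-1" 1] p by simp
  have r: "(r has_integral Beta (s1 + 1) (s2 + 1) * (\<phi> 1 * \<gamma> 1 + \<phi> 0 * \<gamma> 0)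
      + 1 / (s1 + s2 + 1) * (\<phi> 1 * \<gamma> 0 + \<phi> 0 * \<gamma> 1)) {0..1}"
  proof (rule has_integral_eq_rhs)
    show "(r has_integral Beta (s1 + 1) (s2 + 1) * (\<phi> 1 * \<gamma> 1) + Beta (s1 + 1) (s2 + 1) * (\<phi> 0 * \<gamma> 0)
      + 1 / (s1 + s2 + 1) * (\<phi> 1 * \<gamma> 0) + 1 / (s1 + s2 + 1) * (\<phi> 0 * \<gamma> 1)) {0..1}"
      by (rule has_integral_eq[rotated],
          rule has_integral_add[OF has_integral_add[OF has_integral_add[OF
            has_integral_mult_left[OF b] has_integral_mult_left[OF b']]
            has_integral_mult_left[OF p]] has_integral_mult_left[OF p']])
         (simp add: r_def powr_add algebra_simps)
  qed (simp add: algebra_simps)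
  have pointwise: "2 powr (s1 + s2) * (\<phi> (1/2) * \<gamma> (1/2))
      \<le> (\<phi> t * \<gamma> t + r t) + (\<phi> (1 - t) * \<gamma> (1 - t) + r (1 - t))" if t: "t \<in> {0..1}" for t
  proof -
    have mid: "2 powr s * \<psi> (1/2) \<le> \<psi> t + \<psi> (1 - t)" if "s_convex_unit s \<psi>" for s \<psi>
    proof -
      have "\<psi> (1/2) \<le> (1/2) powr s * \<psi> t + (1/2) powr s * \<psi> (1 - t)"
        using that[unfolded s_convex_unit_def, rule_format, of "1/2" t "1 - t"] t
        by (simp add: field_simps)
      then have "2 powr s * \<psi> (1/2) \<le> 2 powr s * ((1/2) powr s * (\<psi> t + \<psi> (1 - t)))"
        by (intro mult_left_mono) (auto simp: algebra_simps)
      also have "2 powr s * ((1/2) powr s * (\<psi> t + \<psi> (1 - t))) = \<psi> t + \<psi> (1 - t)"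
        by (simp add: powr_divide)
      finally show ?thesis .
    qed
    have t': "1 - t \<in> {0..1}" using t by simp
    have "2 powr (s1 + s2) * (\<phi> (1/2) * \<gamma> (1/2)) = (2 powr s1 * \<phi> (1/2)) * (2 powr s2 * \<gamma> (1/2))"
      by (simp add: powr_add)
    also have "\<dots> \<le> (\<phi> t + \<phi> (1 - t)) * (\<gamma> t + \<gamma> (1 - t))"
      using nn1[of "1/2"] nn2[of "1/2"] nn1[OF t] nn1[OF t']
      by (intro mult_mono mid cv1 cv2) auto
    also have "\<dots> = \<phi> t * \<gamma> t + \<phi> (1 - t) * \<gamma> (1 - t) + \<phi> t * \<gamma> (1 - t) + \<phi> (1 - t) * \<gamma> t"
      by (simp add: algebra_simps)
    finally have main: "2 powr (s1 + s2) * (\<phi> (1/2) * \<gamma> (1/2)) \<le>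
      \<phi> t * \<gamma> t + \<phi> (1 - t) * \<gamma> (1 - t) + \<phi> t * \<gamma> (1 - t) + \<phi> (1 - t) * \<gamma> t" .
    have cross: "\<phi> v * \<gamma> (1 - v) \<le> r v" if v: "v \<in> {0..1}" for v
      unfolding r_def
      using v s_convex_unit_le[OF cv1(1) v] s_convex_unit_le[OF cv2(1), of "1 - v"] nn1 nn2
      by (intro mult_mono) auto
    show ?thesis using main cross[OF t] cross[OF t'] by simp
  qed
  have "2 powr (s1 + s2) * (\<phi> (1/2) * \<gamma> (1/2)) \<le> 2 * ?J"
    using le_twice_integral_of_symmetrized[OF has_integral_add[OF h r] pointwise] by (simp only: add.assoc)
  moreover have "a \<le> J" if "b \<le> 2 * J" "a = b / 2" for a b J :: real
    using that by simp
  moreover have "2 powr (s1 + s2 - 1) * \<phi> (1/2) * \<gamma> (1/2)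
      = 2 powr (s1 + s2) * (\<phi> (1/2) * \<gamma> (1/2)) / 2"
    by (simp add: powr_diff)
  ultimately show ?thesis by blast
qed

section \<open>The operator inequality\<close>

text \<open>
  For $s < 1$ the midpoint inequality with both operators equal to $T$ reads
  $f(T) \le 2^{1-s} f(T)$, where $2^{1-s} > 1$.
\<close>

lemma operator_s_convex_nonneg:
  fixes K :: "('h::chilbert_space \<Rightarrow>\<^sub>L 'h) set"
  assumes cv: "operator_s_convex s I K f" and s: "0 < s" "s \<le> 1"
    and one: "s = 1 \<Longrightarrow> \<forall>T\<in>K. spectrum_in T I \<longrightarrow> 0 \<le>\<^sub>o\<^sub>p cfc f T"
    and T: "T \<in> K" "spectrum_in T I"
  shows "0 \<le> qform (cfc f T) x"
proof (cases "s = 1")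
  case True
  moreover have "qform 0 x = 0"
    using qform_combination[of 0 0 0 0 x] by simp
  moreover have "qform 0 x \<le> qform (cfc f T) x"
    using one[OF True] T by (auto simp: op_le_def)
  ultimately show ?thesis by simp
next
  case False
  have "cfc f ((1 - 1/2) *\<^sub>R T + (1/2) *\<^sub>R T) \<le>\<^sub>o\<^sub>p
      ((1 - 1/2) powr s) *\<^sub>R cfc f T + ((1/2) powr s) *\<^sub>R cfc f T"
    using cv T unfolding operator_s_convex_def
    by (elim conjE ballE[where x = "1/2"] ballE[where x = T] impE) simp_all
  then have "qform (cfc f ((1 - 1/2) *\<^sub>R T + (1/2) *\<^sub>R T)) x
      \<le> (1 - 1/2) powr s * qform (cfc f T) x + (1/2) powr s * qform (cfc f T) x"
    unfolding op_le_def qform_combination by blast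
  moreover have "(1 - 1/2) *\<^sub>R T + (1/2) *\<^sub>R T = T"
    unfolding scaleR_left_distrib[symmetric] by simp
  ultimately have "qform (cfc f T) x \<le> 2 * (1/2) powr s * qform (cfc f T) x"
    by (simp only:) (simp add: mult_ac)
  moreover have "1 < 2 * (1/2::real) powr s"
    using False s powr_less_mono'[of "1/2::real" s 1] by simp
  ultimately have "0 \<le> (2 * (1/2) powr s - 1) * qform (cfc f T) x" by (simp add: algebra_simps)
  with \<open>1 < 2 * (1/2::real) powr s\<close> show ?thesis by (simp add: zero_le_mult_iff)
qed

lemma operator_s_convex_imp_s_convex_unit:
  fixes K :: "('h::chilbert_space \<Rightarrow>\<^sub>L 'h) set"
  assumes cv: "operator_s_convex s I K f"
    and seg: "\<And>t. t \<in> {0..1} \<Longrightarrow>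
      t *\<^sub>R A + (1 - t) *\<^sub>R B \<in> K \<and> spectrum_in (t *\<^sub>R A + (1 - t) *\<^sub>R B) I"
  shows "s_convex_unit s (\<lambda>t. qform (cfc f (t *\<^sub>R A + (1 - t) *\<^sub>R B)) x)"
  unfolding s_convex_unit_def
proof (intro ballI)
  fix l t u :: real assume l: "l \<in> {0..1}" and t: "t \<in> {0..1}" and u: "u \<in> {0..1}"
  let ?C = "\<lambda>t. t *\<^sub>R A + (1 - t) *\<^sub>R B"
  have "?C ((1 - l) * t + l * u) = (1 - l) *\<^sub>R ?C t + l *\<^sub>R ?C u"
    by (simp add: algebra_simps)
  moreover have "cfc f ((1 - l) *\<^sub>R ?C t + l *\<^sub>R ?C u) \<le>\<^sub>o\<^sub>p
      ((1 - l) powr s) *\<^sub>R cfc f (?C t) + (l powr s) *\<^sub>R cfc f (?C u)"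
    using cv l seg[OF t] seg[OF u] unfolding operator_s_convex_def by blast
  ultimately show "qform (cfc f (?C ((1 - l) * t + l * u))) x
      \<le> (1 - l) powr s * qform (cfc f (?C t)) x + l powr s * qform (cfc f (?C u)) x"
    by (simp add: op_le_def qform_combination)
qed

theorem theorem8:
  fixes I :: "real set" and K :: "('h::chilbert_space \<Rightarrow>\<^sub>L 'h) set"
    and s1 s2 :: real and f g :: "real \<Rightarrow> real"
    and A B :: "'h \<Rightarrow>\<^sub>L 'h" and x :: 'h
  assumes "is_interval I" and "I \<subseteq> {0..}"
    and "convex K" and "K \<subseteq> positive_ops"
    and "0 < s1" and "s1 \<le> 1" and "0 < s2" and "s2 \<le> 1"
    and "operator_s_convex s1 I K f" and "operator_s_convex s2 I K g"
    and "s1 = 1 \<Longrightarrow> \<forall>T\<in>K. spectrum_in T I \<longrightarrow> 0 \<le>\<^sub>o\<^sub>p cfc f T"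
    and "s2 = 1 \<Longrightarrow> \<forall>T\<in>K. spectrum_in T I \<longrightarrow> 0 \<le>\<^sub>o\<^sub>p cfc g T"
    and "A \<in> K" and "B \<in> K" and "spectrum_in A I" and "spectrum_in B I"
    and "norm x = 1"
  shows "2 powr (s1 + s2 - 1) * qform (cfc f ((1/2) *\<^sub>R (A + B))) x * qform (cfc g ((1/2) *\<^sub>R (A + B))) x
    \<le> integral {0..1} (\<lambda>t. qform (cfc f (t *\<^sub>R A + (1 - t) *\<^sub>R B)) x * qform (cfc g (t *\<^sub>R A + (1 - t) *\<^sub>R B)) x)
      + Beta (s1 + 1) (s2 + 1) * M_form f g A B x
      + 1 / (s1 + s2 + 1) * N_form f g A B x"
proof -
  define C where "C t = t *\<^sub>R A + (1 - t) *\<^sub>R B" for t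
  have sa: "selfadjoint A" "selfadjoint B"
    using assms by (auto simp: positive_ops_def op_le_def)
  have seg: "C t \<in> K \<and> spectrum_in (C t) I" if "t \<in> {0..1}" for t
    using that assms sa unfolding C_def
    by (intro conjI spectrum_in_convex_combination convexD) auto
  have "s_convex_unit s1 (\<lambda>t. qform (cfc f (C t)) x)" "s_convex_unit s2 (\<lambda>t. qform (cfc g (C t)) x)"
    using assms seg unfolding C_def by (blast intro: operator_s_convex_imp_s_convex_unit)+
  moreover have "0 \<le> qform (cfc f (C t)) x" "0 \<le> qform (cfc g (C t)) x" if "t \<in> {0..1}" for t
    using assms seg[OF that] by (blast intro: operator_s_convex_nonneg)+
  ultimately have "2 powr (s1 + s2 - 1) * qform (cfc f (C (1/2))) x * qform (cfc g (C (1/2))) x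
    \<le> integral {0..1} (\<lambda>t. qform (cfc f (C t)) x * qform (cfc g (C t)) x)
      + Beta (s1 + 1) (s2 + 1) * M_form f g (C 1) (C 0) x
      + 1 / (s1 + s2 + 1) * N_form f g (C 1) (C 0) x"
    unfolding M_form_def N_form_def
    using assms by (intro s_convex_unit_product_Hadamard) auto
  moreover have "C 1 = A" "C 0 = B" "C (1/2) = (1/2) *\<^sub>R (A + B)"
    by (simp_all add: C_def scaleR_right_distrib)
  ultimately show ?thesis by (simp add: C_def)
qed

end
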